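(* Let $\mathtt p=\{p_i,\ i\ge0\}$ be a non-degenerate discrete probability distribution, i.e. $p_i\in(0,1)$ for all $i\ge0$ and $\sum_{i\ge0}p_i=1$. Then all the entropies defined in the context take strictly positive values for all admissible values of the parameters. More precisely, let $\mu(\mathtt p):=\max_{i\ge0}p_i\in(0,1)$; then $$\mathbf H_{SH}(\mathtt p)\ge-\log\mu(\mathtt p)>0,$$ $$\mathbf H_{R}(\alpha,\mathtt p)\ge-\log\mu(\mathtt p)>0,$$ $$\mathbf H_{GR}(\alpha,\mathtt p)\ge-\log\mu(\mathtt p)>0,$$ $$\mathbf H_{GR}(\alpha,\beta,\mathtt p)\ge-\log\mu(\mathtt p)>0,$$ $$\mathbf H_{T}(\alpha,\mathtt p)\ge\frac1{1-\alpha}\bigl(\mu(\mathtt p)^{\alpha-1}-1\bigr)>0,$$ $$\mathbf H_{SM}(\alpha,\beta,\mathtt p)\ge\frac1{1-\beta}\bigl(\mu(\mathtt p)^{\beta-1}-1\bigr)>0.$$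
   Context: $\log$ is the natural logarithm. For a non-degenerate discrete distribution $\mathtt p=\{p_i,i\ge0\}$ the entropies, with their admissible parameters, are: $\mathbf H_{SH}(\mathtt p)=-\sum_{i\ge0}p_i\log p_i$ (Shannon); $\mathbf H_R(\alpha,\mathtt p)=\frac1{1-\alpha}\log\sum_{i\ge0}p_i^\alpha$, $\alpha>0$, $\alpha\neq1$ (Rényi); $\mathbf H_{GR}(\alpha,\mathtt p)=-\frac{\sum_{i\ge0}p_i^\alpha\log p_i}{\sum_{i\ge0}p_i^\alpha}$, $\alpha>0$ (one-parameter generalized Rényi); $\mathbf H_{GR}(\alpha,\beta,\mathtt p)=\frac1{\beta-\alpha}\log\frac{\sum_{i\ge0}p_i^\alpha}{\sum_{i\ge0}p_i^\beta}$, $\alpha,\beta>0$, $\alpha\ne\beta$ (two-parameter generalized Rényi); $\mathbf H_T(\alpha,\mathtt p)=\frac1{1-\alpha}\bigl(\sum_{i\ge0}p_i^\alpha-1\bigr)$, $\alpha>0$, $\alpha\ne1$ (Tsallis); $\mathbf H_{SM}(\alpha,\beta,\mathtt p)=\frac1{1-\beta}\Bigl(\bigl(\sum_{i\ge0}p_i^\alpha\bigr)^{\frac{1-\beta}{1-\alpha}}-1\Bigr)$, $\alpha,\beta>0$, $\alpha\neq1$, $\beta\ne1$ (Sharma--Mittal). *)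

theory Defs
  imports "HOL-Analysis.Analysis"
begin

text \<open>
  For a distribution \<open>p\<close> on the natural numbers the series entering the entropies may diverge
  (e.g. \<open>\<Sum>i. p i powr \<alpha>\<close> for \<open>\<alpha> < 1\<close>, or the Shannon series). All entropies are therefore
  extended reals. With \<open>0 < p i < 1\<close> the terms of each series below have constant sign, so every
  series has a value in \<open>ereal\<close>.
\<close>

definition ereal_ln :: "ereal \<Rightarrow> ereal" where
  "ereal_ln x = (case x of
      ereal r \<Rightarrow> (if 0 < r then ereal (ln r) else - \<infinity>)
    | PInfty \<Rightarrow> \<infinity>
    | MInfty \<Rightarrow> - \<infinity>)"

text \<open>Only used for bases in \<open>(0, \<infinity>]\<close>; the values at \<open>\<infinity>\<close> are the limits of \<open>r powr e\<close> as \<open>r \<rightarrow> \<infinity>\<close>.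
  The value at \<open>- \<infinity>\<close> is a dummy.\<close>

definition ereal_powr :: "ereal \<Rightarrow> real \<Rightarrow> ereal" where
  "ereal_powr x e = (case x of
      ereal r \<Rightarrow> ereal (r powr e)
    | PInfty \<Rightarrow> (if 0 < e then \<infinity> else if e = 0 then 1 else 0)
    | MInfty \<Rightarrow> 0)"

definition power_sum :: "real \<Rightarrow> (nat \<Rightarrow> real) \<Rightarrow> ereal" where
  "power_sum \<alpha> p = (\<Sum>i. ereal (p i powr \<alpha>))"

definition H_SH :: "(nat \<Rightarrow> real) \<Rightarrow> ereal" where
  "H_SH p = - (\<Sum>i. ereal (p i * ln (p i)))"

definition H_R :: "real \<Rightarrow> (nat \<Rightarrow> real) \<Rightarrow> ereal" where
  "H_R \<alpha> p = ereal (1 / (1 - \<alpha>)) * ereal_ln (power_sum \<alpha> p)"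

text \<open>The quotients in the next two definitions carry no meaning when numerator and denominator
  are both infinite (\<open>ereal\<close> then returns a default value).\<close>

definition H_GR1 :: "real \<Rightarrow> (nat \<Rightarrow> real) \<Rightarrow> ereal" where
  "H_GR1 \<alpha> p = - ((\<Sum>i. ereal (p i powr \<alpha> * ln (p i))) / power_sum \<alpha> p)"

definition H_GR2 :: "real \<Rightarrow> real \<Rightarrow> (nat \<Rightarrow> real) \<Rightarrow> ereal" where
  "H_GR2 \<alpha> \<beta> p = ereal (1 / (\<beta> - \<alpha>)) * ereal_ln (power_sum \<alpha> p / power_sum \<beta> p)"

definition H_T :: "real \<Rightarrow> (nat \<Rightarrow> real) \<Rightarrow> ereal" where
  "H_T \<alpha> p = ereal (1 / (1 - \<alpha>)) * (power_sum \<alpha> p - 1)"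

definition H_SM :: "real \<Rightarrow> real \<Rightarrow> (nat \<Rightarrow> real) \<Rightarrow> ereal" where
  "H_SM \<alpha> \<beta> p =
     ereal (1 / (1 - \<beta>)) * (ereal_powr (power_sum \<alpha> p) ((1 - \<beta>) / (1 - \<alpha>)) - 1)"

definition nondegenerate_distribution :: "(nat \<Rightarrow> real) \<Rightarrow> bool" where
  "nondegenerate_distribution p \<longleftrightarrow> (\<forall>i. 0 < p i \<and> p i < 1) \<and> p sums 1"

text \<open>The maximum of the infinite set \<open>range p\<close>; \<open>Max\<close> only covers finite sets.\<close>

definition max_prob :: "(nat \<Rightarrow> real) \<Rightarrow> real" where
  "max_prob p = (GREATEST x. x \<in> range p)"

end

(*
  With m the largest probability and S(a) the sum of the p_i^a, comparing terms gives
  S(b) <= m^(b - a) S(a) for a < b; for positive finite sums this is exactly H_GR(a, b) >= -log m.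
  Renyi entropy is the case b = 1.  Sharma--Mittal entropy is the increasing function
  h |-> (exp((1 - b) h) - 1) / (1 - b) of the Renyi entropy, and Tsallis entropy is Sharma--Mittal
  entropy with a = b.  In the Shannon and one-parameter cases each -log p_i is at least -log m.
*)
theory Submission
  imports Defs
begin

section \<open>Auxiliary facts: nonpositive series, and the function x |-> (exp(c x) - 1) /
  c\<close>

lemma suminf_ereal_nonpos:
  fixes f :: "nat \<Rightarrow> real"
  assumes "\<And>i. f i \<le> 0"
  shows "(\<Sum>i. ereal (f i)) = - (\<Sum>i. ereal (- f i))"
proof -
  have "(\<lambda>i. ereal (- f i)) sums (\<Sum>i. ereal (- f i))"
    by (intro summable_sums summable_ereal_pos) (simp add: assms)
  \<comment> \<open>Negation is continuous on \<open>ereal\<close>, so this step also covers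
    divergent series.\<close>
  then have "(\<lambda>n. - (\<Sum>i<n. ereal (- f i))) \<longlonglongrightarrow> - (\<Sum>i. ereal (- f i))"
    unfolding sums_def by (rule tendsto_uminus_ereal)
  moreover have "- (\<Sum>i<n. ereal (- f i)) = (\<Sum>i<n. ereal (f i))" for n
    by (simp add: sum_negf)
  ultimately have "(\<lambda>i. ereal (f i)) sums - (\<Sum>i. ereal (- f i))"
    unfolding sums_def by simp
  then show ?thesis by (rule sums_unique[symmetric])
qed

text \<open>For negative c, multiplying by c and dividing by c each reverse the order, and the two
  reversals cancel.\<close>

lemma exp_scaled_mono:
  fixes c :: real
  assumes "c \<noteq> 0" "x \<le> y"
  shows "(exp (c * x) - 1) / c \<le> (exp (c * y) - 1) / c"
proof (cases "c > 0")
  case True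
  with assms show ?thesis by (simp add: divide_right_mono)
next
  case False
  with assms show ?thesis by (simp add: divide_right_mono_neg mult_left_mono_neg)
qed

lemma exp_scaled_pos:
  fixes c :: real
  assumes "c \<noteq> 0" "x > 0"
  shows "(exp (c * x) - 1) / c > 0"
  using assms by (cases "c > 0") (auto simp: zero_less_divide_iff mult_less_0_iff)

section \<open>The largest probability\<close>

context
  fixes p :: "nat \<Rightarrow> real"
  assumes nondeg: "nondegenerate_distribution p"
begin

lemma prob_pos: "0 < p i" and prob_less_one: "p i < 1"
  and prob_sums: "p sums 1"
  using nondeg by (auto simp: nondegenerate_distribution_def)

text \<open>Since p tends to 0, all terms from some index n on lie below \<open>p 0\<close>, so the
  maximum over the finite segment up to n is global.\<close>

lemma prob_attains_max: "\<exists>k. \<forall>i. p i \<le> p k"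
proof -
  have "p \<longlonglongrightarrow> 0"
    using prob_sums by (simp add: summable_LIMSEQ_zero sums_iff)
  then have "eventually (\<lambda>i. p i < p 0) sequentially"
    by (rule order_tendstoD) (rule prob_pos)
  then obtain n where n: "\<And>i. i \<ge> n \<Longrightarrow> p i < p 0"
    by (auto simp: eventually_sequentially)
  have "Max (p ` {..n}) \<in> p ` {..n}" by (rule Max_in) auto
  then obtain k where k: "p k = Max (p ` {..n})" by force
  have le: "p i \<le> p k" if "i \<le> n" for i
    unfolding k using that by (intro Max_ge) auto
  have "p i \<le> p k" for i
  proof (cases "i \<le> n")
    case False
    then have "p i < p 0" by (intro n) simp
    with le[of 0] show ?thesis by simp
  qed (rule le)
  then show ?thesis by blast
qed

lemma max_prob_in_range: "max_prob p \<in> range p"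
  and prob_le_max_prob: "p i \<le> max_prob p"
proof -
  obtain k where k: "\<And>i. p i \<le> p k" using prob_attains_max by blast
  then have "max_prob p = p k"
    unfolding max_prob_def by (intro Greatest_equality) auto
  with k show "max_prob p \<in> range p" "p i \<le> max_prob p" by auto
qed

lemma max_prob_pos: "0 < max_prob p" and max_prob_less_one: "max_prob p < 1"
  using max_prob_in_range prob_pos prob_less_one by auto

lemma neg_ln_max_prob_le: "- ln (max_prob p) \<le> - ln (p i)"
  using prob_pos[of i] max_prob_pos prob_le_max_prob[of i] by simp

lemma neg_ln_max_prob_pos: "0 < - ln (max_prob p)"
  using max_prob_pos max_prob_less_one by simp

section \<open>Power sums and their comparison\<close>

lemma power_sum_one: "power_sum 1 p = 1"
proof -
  have "(\<lambda>i. ereal (p i powr 1)) sums ereal 1"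
    using prob_sums prob_pos by (simp add: sums_ereal less_imp_le)
  then show ?thesis by (simp add: power_sum_def sums_iff one_ereal_def)
qed

lemma power_sum_pos: "0 < power_sum \<alpha> p"
proof -
  have "0 < ereal (p 0 powr \<alpha>)" using prob_pos[of 0] by simp
  also have "\<dots> = (\<Sum>i<1. ereal (p i powr \<alpha>))" by simp
  also have "\<dots> \<le> power_sum \<alpha> p"
    unfolding power_sum_def by (rule suminf_upper) simp
  finally show ?thesis .
qed

lemma power_sum_cases:
  obtains (finite) s where "power_sum \<alpha> p = ereal s" "0 < s" | (infinite) "power_sum \<alpha> p = \<infinity>"
  using power_sum_pos[of \<alpha>] by (cases "power_sum \<alpha> p") auto

text \<open>Stated in \<open>ereal\<close> so that it also transfers divergence: the factor is
  finite, hence an infinite sum at \<beta> forces one at \<alpha>.\<close>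

lemma power_sum_le:
  assumes "\<alpha> \<le> \<beta>"
  shows "power_sum \<beta> p \<le> ereal (max_prob p powr (\<beta> - \<alpha>)) * power_sum \<alpha> p"
proof -
  have "p i powr \<beta> \<le> max_prob p powr (\<beta> - \<alpha>) * p i powr \<alpha>" for i
  proof -
    have "p i powr \<beta> = p i powr (\<beta> - \<alpha>) * p i powr \<alpha>"
      by (simp flip: powr_add)
    also have "\<dots> \<le> max_prob p powr (\<beta> - \<alpha>) * p i powr \<alpha>"
      using assms prob_pos[of i] prob_le_max_prob[of i]
      by (intro mult_right_mono powr_mono2) auto
    finally show ?thesis .
  qed
  then have "power_sum \<beta> p \<le> (\<Sum>i. ereal (max_prob p powr (\<beta> - \<alpha>)) * ereal (p i powr \<alpha>))"
    unfolding power_sum_def by (intro suminf_le_pos) auto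
  also have "\<dots> = ereal (max_prob p powr (\<beta> - \<alpha>)) * power_sum \<alpha> p"
    unfolding power_sum_def by (rule suminf_cmult_ereal) auto
  finally show ?thesis .
qed

lemma ln_power_sum_le:
  assumes "\<alpha> \<le> \<beta>" "power_sum \<alpha> p = ereal s" "power_sum \<beta> p = ereal t" "0 < s" "0 < t"
  shows "(\<beta> - \<alpha>) * - ln (max_prob p) \<le> ln s - ln t"
proof -
  have "t \<le> max_prob p powr (\<beta> - \<alpha>) * s"
    using power_sum_le[OF assms(1)] assms by simp
  then have "ln t \<le> ln (max_prob p powr (\<beta> - \<alpha>) * s)"
    using assms by simp
  also have "\<dots> = (\<beta> - \<alpha>) * ln (max_prob p) + ln s"
    using assms max_prob_pos by (simp add: ln_mult ln_powr)
  finally show ?thesis by simp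
qed

section \<open>Lower bounds for the entropies\<close>

lemma H_GR2_ge:
  assumes "\<alpha> \<noteq> \<beta>" "power_sum \<alpha> p \<noteq> \<infinity> \<or> power_sum \<beta> p \<noteq> \<infinity>"
  shows "ereal (- ln (max_prob p)) \<le> H_GR2 \<alpha> \<beta> p"
proof -
  have mono: "power_sum \<gamma> p = \<infinity>" if "\<gamma> \<le> \<delta>" "power_sum \<delta> p = \<infinity>" for \<gamma> \<delta>
    using power_sum_le[OF that(1)] that(2) by (cases \<gamma> rule: power_sum_cases) auto
  show ?thesis
  proof (cases \<alpha> rule: power_sum_cases)
    case (finite s)
    note s = this
    show ?thesis
    proof (cases \<beta> rule: power_sum_cases)
      case (finite t)
      have "- ln (max_prob p) \<le> (ln s - ln t) / (\<beta> - \<alpha>)"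
      proof (cases "\<alpha> < \<beta>")
        case True
        with ln_power_sum_le[of \<alpha> \<beta> s t] s finite show ?thesis
          by (simp add: field_simps)
      next
        case False
        \<comment> \<open>The quotient is unchanged when (\<alpha>, s) and (\<beta>, t) are
          swapped.\<close>
        with ln_power_sum_le[of \<beta> \<alpha> t s] s finite assms(1) show ?thesis
          by (simp add: field_simps)
      qed
      with s finite show ?thesis
        by (simp add: H_GR2_def ereal_ln_def ln_div)
    next
      case infinite
      \<comment> \<open>The quotient of the sums is 0, whose \<open>ereal_ln\<close> is
        -\<infinity>; the negative prefactor turns this into \<infinity>.\<close>
      with s mono[of \<alpha> \<beta>] have "\<beta> < \<alpha>" by force
      with s infinite show ?thesis by (simp add: H_GR2_def ereal_ln_def zero_ereal_def)
    qed
  next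
    case infinite
    with assms obtain t where t: "power_sum \<beta> p = ereal t" "0 < t"
      by (cases \<beta> rule: power_sum_cases) auto
    \<comment> \<open>Here the quotient is \<infinity> and the prefactor is positive, so the entropy
      is again \<infinity>.\<close>
    with infinite mono[of \<beta> \<alpha>] have "\<alpha> < \<beta>" by force
    with t infinite show ?thesis by (simp add: H_GR2_def ereal_ln_def)
  qed
qed

text \<open>The power sum at 1 is finite, so \<open>H_GR2_ge\<close> applies even when the one at
  \<alpha> diverges.\<close>

lemma H_R_ge:
  assumes "\<alpha> \<noteq> 1"
  shows "ereal (- ln (max_prob p)) \<le> H_R \<alpha> p"
  using H_GR2_ge[of \<alpha> 1] assms by (simp add: H_GR2_def H_R_def power_sum_one)

text \<open>The terms are nonpositive, so the comparison is made on the negated series. Without a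
  quotient the bound survives divergence; it serves both the Shannon case (\<alpha> = 1) and
  \<open>H_GR1\<close>.\<close>

lemma suminf_powr_ln_le:
  "(\<Sum>i. ereal (p i powr \<alpha> * ln (p i))) \<le> ereal (ln (max_prob p)) * power_sum \<alpha> p"
proof -
  have "ereal (- ln (max_prob p)) * power_sum \<alpha> p
      = (\<Sum>i. ereal (- ln (max_prob p)) * ereal (p i powr \<alpha>))"
    unfolding power_sum_def using neg_ln_max_prob_pos
    by (intro suminf_cmult_ereal[symmetric]) auto
  also have "\<dots> \<le> (\<Sum>i. ereal (- (p i powr \<alpha> * ln (p i))))"
  proof (rule suminf_le_pos)
    show "ereal (- ln (max_prob p)) * ereal (p i powr \<alpha>) \<le> ereal (- (p i powr \<alpha> * ln (p i)))" for i
      using mult_right_mono[OF neg_ln_max_prob_le, of "p i powr \<alpha>" i] by (simp add: mult.commute)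
    show "0 \<le> ereal (- ln (max_prob p)) * ereal (p i powr \<alpha>)" for i
      using neg_ln_max_prob_pos by (simp add: mult_nonpos_nonneg)
  qed
  also have "\<dots> = - (\<Sum>i. ereal (p i powr \<alpha> * ln (p i)))"
    using prob_pos prob_less_one
    by (subst suminf_ereal_nonpos) (auto simp: mult_le_0_iff less_imp_le)
  finally show ?thesis
    by (metis ereal_minus_le_minus ereal_mult_minus_left uminus_ereal.simps(1))
qed

lemma H_SH_ge: "ereal (- ln (max_prob p)) \<le> H_SH p"
proof -
  have "(\<Sum>i. ereal (p i * ln (p i))) \<le> ereal (ln (max_prob p))"
    using suminf_powr_ln_le[of 1] prob_pos by (simp add: power_sum_one less_imp_le)
  then show ?thesis
    unfolding H_SH_def by (metis ereal_minus_le_minus uminus_ereal.simps(1))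
qed

text \<open>If the power sum were infinite, \<open>suminf_powr_ln_le\<close> would make the
  numerator -\<infinity> and the quotient a mere default value. Otherwise one divides that bound by
  a finite positive number.\<close>

lemma H_GR1_ge:
  assumes "power_sum \<alpha> p \<noteq> \<infinity>"
  shows "ereal (- ln (max_prob p)) \<le> H_GR1 \<alpha> p"
proof -
  have "(\<Sum>i. ereal (p i powr \<alpha> * ln (p i))) / power_sum \<alpha> p \<le> ereal (ln (max_prob p))"
    using suminf_powr_ln_le[of \<alpha>] power_sum_pos[of \<alpha>] assms
    by (subst ereal_divide_le_pos) (auto simp: mult.commute)
  then show ?thesis
    unfolding H_GR1_def by (metis ereal_minus_le_minus uminus_ereal.simps(1))
qed

lemma H_SM_ge:
  assumes "\<alpha> \<noteq> 1" "\<beta> \<noteq> 1"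
  shows "ereal (1 / (1 - \<beta>) * (max_prob p powr (\<beta> - 1) - 1)) \<le> H_SM \<alpha> \<beta> p"
proof (cases \<alpha> rule: power_sum_cases)
  case (finite s)
  \<comment> \<open>This is the R\<e>nyi entropy as a real number.\<close>
  define h where "h = ln s / (1 - \<alpha>)"
  have "- ln (max_prob p) \<le> h"
    using H_R_ge[OF assms(1)] finite by (simp add: H_R_def ereal_ln_def h_def)
  then have "(exp ((1 - \<beta>) * - ln (max_prob p)) - 1) / (1 - \<beta>) \<le> (exp ((1 - \<beta>) * h) - 1) / (1 - \<beta>)"
    using assms by (intro exp_scaled_mono) auto
  moreover have "exp ((1 - \<beta>) * - ln (max_prob p)) = max_prob p powr (\<beta> - 1)"
    using max_prob_pos by (simp add: powr_def algebra_simps)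
  moreover have "exp ((1 - \<beta>) * h) = s powr ((1 - \<beta>) / (1 - \<alpha>))"
    using finite by (simp add: powr_def h_def)
  ultimately show ?thesis
    using finite by (simp add: H_SM_def ereal_powr_def one_ereal_def)
next
  case infinite
  \<comment> \<open>For \<alpha> \<ge> 1 the power sum is bounded by a finite multiple of the sum at
    1, which is 1.\<close>
  have "\<alpha> < 1"
  proof (rule ccontr)
    assume "\<not> \<alpha> < 1"
    with power_sum_le[of 1 \<alpha>] infinite show False by (simp add: power_sum_one)
  qed
  show ?thesis
  proof (cases "\<beta> < 1")
    case True
    \<comment> \<open>The exponent is positive, so the entropy is \<infinity>.\<close>
    with \<open>\<alpha> < 1\<close> infinite show ?thesis by (simp add: H_SM_def ereal_powr_def)
  next
    case False
    \<comment> \<open>Now \<beta> > 1 and the exponent is negative, so \<open>ereal_powr\<close>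
      gives 0. The bound follows from dropping the nonnegative power of the maximum under a negative
      prefactor.\<close>
    with assms \<open>\<alpha> < 1\<close> have "\<not> 0 < (1 - \<beta>) / (1 - \<alpha>)" "(1 - \<beta>) / (1 - \<alpha>) \<noteq> 0"
      by (auto simp: zero_less_divide_iff)
    then have "H_SM \<alpha> \<beta> p = ereal (- 1 / (1 - \<beta>))"
      using infinite unfolding H_SM_def ereal_powr_def by (simp add: one_ereal_def)
    moreover have "1 / (1 - \<beta>) * (max_prob p powr (\<beta> - 1) - 1) \<le> 1 / (1 - \<beta>) * (- 1)"
      using False by (intro mult_left_mono_neg) auto
    ultimately show ?thesis by simp
  qed
qed

lemma H_T_ge:
  assumes "\<alpha> \<noteq> 1"
  shows "ereal (1 / (1 - \<alpha>) * (max_prob p powr (\<alpha> - 1) - 1)) \<le> H_T \<alpha> p"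
proof -
  \<comment> \<open>Positivity matters: \<open>ereal_powr\<close> with exponent 1 is not the
    identity on negative arguments.\<close>
  have "ereal_powr (power_sum \<alpha> p) 1 = power_sum \<alpha> p"
    by (cases \<alpha> rule: power_sum_cases) (auto simp: ereal_powr_def)
  then have "H_SM \<alpha> \<alpha> p = H_T \<alpha> p"
    using assms by (simp add: H_SM_def H_T_def)
  with H_SM_ge[OF assms assms] show ?thesis by simp
qed

text \<open>With c = 1 - \<beta>, the bound is the value of (exp(c x) - 1) / c at x = -log m >
  0.\<close>

lemma power_bound_pos:
  assumes "\<beta> \<noteq> 1"
  shows "0 < 1 / (1 - \<beta>) * (max_prob p powr (\<beta> - 1) - 1)"
proof -
  have "exp ((1 - \<beta>) * - ln (max_prob p)) = max_prob p powr (\<beta> - 1)"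
    using max_prob_pos by (simp add: powr_def algebra_simps)
  with exp_scaled_pos[of "1 - \<beta>" "- ln (max_prob p)"] assms neg_ln_max_prob_pos show ?thesis
    by simp
qed

end

theorem proposition2p3:
  fixes p :: "nat \<Rightarrow> real"
  assumes "nondegenerate_distribution p"
  shows "(max_prob p \<in> range p \<and> (\<forall>i. p i \<le> max_prob p) \<and> 0 < max_prob p \<and> max_prob p < 1)
    \<and> - ln (max_prob p) > 0
    \<and> H_SH p \<ge> ereal (- ln (max_prob p))
    \<and> (\<forall>\<alpha>. \<alpha> > 0 \<and> \<alpha> \<noteq> 1 \<longrightarrow>
         H_R \<alpha> p \<ge> ereal (- ln (max_prob p)))
    \<and> (\<forall>\<alpha>. \<alpha> > 0 \<and> power_sum \<alpha> p \<noteq> \<infinity> \<longrightarrow>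
         H_GR1 \<alpha> p \<ge> ereal (- ln (max_prob p)))
    \<and> (\<forall>\<alpha> \<beta>. \<alpha> > 0 \<and> \<beta> > 0 \<and> \<alpha> \<noteq> \<beta> \<and> (power_sum \<alpha> p \<noteq> \<infinity> \<or> power_sum \<beta> p \<noteq> \<infinity>) \<longrightarrow>
         H_GR2 \<alpha> \<beta> p \<ge> ereal (- ln (max_prob p)))
    \<and> (\<forall>\<alpha>. \<alpha> > 0 \<and> \<alpha> \<noteq> 1 \<longrightarrow>
         H_T \<alpha> p \<ge> ereal (1 / (1 - \<alpha>) * (max_prob p powr (\<alpha> - 1) - 1))
         \<and> 1 / (1 - \<alpha>) * (max_prob p powr (\<alpha> - 1) - 1) > 0)
    \<and> (\<forall>\<alpha> \<beta>. \<alpha> > 0 \<and> \<beta> > 0 \<and> \<alpha> \<noteq> 1 \<and> \<beta> \<noteq> 1 \<longrightarrow>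
         H_SM \<alpha> \<beta> p \<ge> ereal (1 / (1 - \<beta>) * (max_prob p powr (\<beta> - 1) - 1))
         \<and> 1 / (1 - \<beta>) * (max_prob p powr (\<beta> - 1) - 1) > 0)"
  using max_prob_in_range[OF assms] prob_le_max_prob[OF assms] max_prob_pos[OF assms]
    max_prob_less_one[OF assms] neg_ln_max_prob_pos[OF assms] H_SH_ge[OF assms] H_R_ge[OF assms]
    H_GR1_ge[OF assms] H_GR2_ge[OF assms] H_T_ge[OF assms] H_SM_ge[OF assms]
    power_bound_pos[OF assms]
  by (intro conjI allI impI) blast+

end
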